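(* Suppose that an extension $L$ of $\mathsf{N4}^\bot$ can be axiomatized as $L=\mathsf{N4}^\bot+X$, where $X$ is a set of formulas each of the form $\psi(p_1,\dots,p_n,\ q_1\vee\sim q_1,\dots,q_m\vee\sim q_m)$ with $\psi(p_1,\dots,p_n,q_1,\dots,q_m)$ a formula in the language $\{\wedge,\vee,\to,\bot\}$ and $\{p_1,\dots,p_n\}\cap\{q_1,\dots,q_m\}=\varnothing$ ($m=0$ allowed). Then $\tau_{\mathbf{B}}L$ is a modal companion of $L$.
   Context: Languages: $\mathcal{L}_\sim=\{\wedge,\vee,\to,\bot,\sim\}$ and $\mathcal{L}^\Box_\sim=\mathcal{L}_\sim\cup\{\Box,\Diamond\}$, formulas over a countable set of variables; $\neg\varphi:=\varphi\to\bot$, $\varphi\leftrightarrow\psi:=(\varphi\to\psi)\wedge(\psi\to\varphi)$, $\varphi\Leftrightarrow\psi:=(\varphi\leftrightarrow\psi)\wedge(\sim\varphi\leftrightarrow\sim\psi)$. A logic in $\mathcal{L}_\sim$ is a set of formulas closed under substitution and modus ponens; a logic in $\mathcal{L}^\Box_\sim$ is additionally closed under $\varphi\to\psi/\Box\varphi\to\Box\psi$ and $\varphi\to\psi/\Diamond\varphi\to\Diamond\psi$. $\mathsf{N4}^\bot$ is the least logic in $\mathcal{L}_\sim$ containing the intuitionistic axioms ($p\to(q\to p)$; $(p\to(q\to r))\to((p\to q)\to(p\to r))$; $p\wedge q\to p$; $p\wedge q\to q$; $p\to(q\to p\wedge q)$; $p\to p\vee q$; $q\to p\vee q$; $(p\to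 r)\to((q\to r)\to(p\vee q\to r))$; $\bot\to p$) and $\sim(p\vee q)\leftrightarrow(\sim p\wedge\sim q)$, $\sim(p\wedge q)\leftrightarrow(\sim p\vee\sim q)$, $\sim(p\to q)\leftrightarrow(p\wedge\sim q)$, $\sim\sim p\leftrightarrow p$, $\sim\bot$. $\mathsf{BS4}$ is the least logic in $\mathcal{L}^\Box_\sim$ containing these axioms, $p\vee\neg p$, $\Box(p\to p)$, $(\Box p\wedge\Box q)\to\Box(p\wedge q)$, $\Box p\to p$, $\Box p\to\Box\Box p$, $\neg\Box p\leftrightarrow\Diamond\neg p$, $\neg\Diamond p\leftrightarrow\Box\neg p$, $\Box p\Leftrightarrow\sim\Diamond\sim p$, $\Diamond p\Leftrightarrow\sim\Box\sim p$. Extensions are logics containing the given one; $L+X$ is the least logic containing $L\cup X$. Translation $\mathrm{T}_{\mathbf{B}}$: $\mathrm{T}_{\mathbf{B}}(p)=\Box p$, $\mathrm{T}_{\mathbf{B}}(\sim p)=\Box\sim p$, $\mathrm{T}_{\mathbf{B}}(\bot)=\bot$, $\mathrm{T}_{\mathbf{B}}(\sim\bot)=\sim\bot$, $\mathrm{T}_{\mathbf{B}}(\varphi\wedge\psi)=\mathrm{T}_{\mathbf{B}}\varphi\wedge\mathrm{T}_{\mathbf{B}}\psi$, $\mathrm{T}_{\mathbf{B}}(\varphi\vee\psi)=\mathrm{T}_{\mathbf{B}}\varphi\vee\mathrm{T}_{\mathbf{B}}\psi$, $\mathrm{T}_{\mathbf{B}}(\varphi\to\psi)=\Box(\mathrm{T}_{\mathbf{B}}\varphi\to\mathrm{T}_{\mathbf{B}}\psi)$,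 $\mathrm{T}_{\mathbf{B}}(\sim(\varphi\wedge\psi))=\mathrm{T}_{\mathbf{B}}(\sim\varphi)\vee\mathrm{T}_{\mathbf{B}}(\sim\psi)$, $\mathrm{T}_{\mathbf{B}}(\sim(\varphi\vee\psi))=\mathrm{T}_{\mathbf{B}}(\sim\varphi)\wedge\mathrm{T}_{\mathbf{B}}(\sim\psi)$, $\mathrm{T}_{\mathbf{B}}(\sim(\varphi\to\psi))=\mathrm{T}_{\mathbf{B}}\varphi\wedge\mathrm{T}_{\mathbf{B}}(\sim\psi)$, $\mathrm{T}_{\mathbf{B}}(\sim\sim\varphi)=\mathrm{T}_{\mathbf{B}}\varphi$. A modal companion of an extension $L$ of $\mathsf{N4}^\bot$ is an extension $M$ of $\mathsf{BS4}$ with $\varphi\in L\iff\mathrm{T}_{\mathbf{B}}\varphi\in M$ for every $\mathcal{L}_\sim$-formula $\varphi$; $\tau_{\mathbf{B}}L:=\mathsf{BS4}+\{\mathrm{T}_{\mathbf{B}}\varphi:\varphi\in L\}$. *)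

theory Defs
  imports Main
begin

datatype fm =
    Var nat
  | Bot  ("\<^bold>\<bottom>")
  | Con fm fm  (infixr "\<^bold>\<and>" 65)
  | Dis fm fm  (infixr "\<^bold>\<or>" 60)
  | Imp fm fm  (infixr "\<^bold>\<rightarrow>" 55)
  | SNeg fm  ("\<^bold>\<sim> _" [70] 70)

abbreviation Iff :: "fm \<Rightarrow> fm \<Rightarrow> fm"  (infix "\<^bold>\<leftrightarrow>" 50) where
  "\<phi> \<^bold>\<leftrightarrow> \<psi> \<equiv> (\<phi> \<^bold>\<rightarrow> \<psi>) \<^bold>\<and> (\<psi> \<^bold>\<rightarrow> \<phi>)"

datatype mfm =
    MVar nat
  | MBot  ("\<^bold>\<bottom>\<^sub>m")
  | MCon mfm mfm  (infixr "\<^bold>\<and>\<^sub>m" 65)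
  | MDis mfm mfm  (infixr "\<^bold>\<or>\<^sub>m" 60)
  | MImp mfm mfm  (infixr "\<^bold>\<rightarrow>\<^sub>m" 55)
  | MSNeg mfm  ("\<^bold>\<sim>\<^sub>m _" [70] 70)
  | Box mfm  ("\<^bold>\<box> _" [70] 70)
  | Dia mfm  ("\<^bold>\<diamond> _" [70] 70)

abbreviation MNeg :: "mfm \<Rightarrow> mfm"  ("\<^bold>\<not>\<^sub>m _" [70] 70) where
  "\<^bold>\<not>\<^sub>m \<phi> \<equiv> \<phi> \<^bold>\<rightarrow>\<^sub>m \<^bold>\<bottom>\<^sub>m"

abbreviation MIff :: "mfm \<Rightarrow> mfm \<Rightarrow> mfm"  (infix "\<^bold>\<leftrightarrow>\<^sub>m" 50) where
  "\<phi> \<^bold>\<leftrightarrow>\<^sub>m \<psi> \<equiv> (\<phi> \<^bold>\<rightarrow>\<^sub>m \<psi>) \<^bold>\<and>\<^sub>m (\<psi> \<^bold>\<rightarrow>\<^sub>m \<phi>)"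

abbreviation MSIff :: "mfm \<Rightarrow> mfm \<Rightarrow> mfm"  (infix "\<^bold>\<Leftrightarrow>\<^sub>m" 50) where
  "\<phi> \<^bold>\<Leftrightarrow>\<^sub>m \<psi> \<equiv> (\<phi> \<^bold>\<leftrightarrow>\<^sub>m \<psi>) \<^bold>\<and>\<^sub>m (\<^bold>\<sim>\<^sub>m \<phi> \<^bold>\<leftrightarrow>\<^sub>m \<^bold>\<sim>\<^sub>m \<psi>)"

primrec subst :: "(nat \<Rightarrow> fm) \<Rightarrow> fm \<Rightarrow> fm" where
  "subst \<sigma> (Var x) = \<sigma> x"
| "subst \<sigma> \<^bold>\<bottom> = \<^bold>\<bottom>"
| "subst \<sigma> (\<phi> \<^bold>\<and> \<psi>) = (subst \<sigma> \<phi> \<^bold>\<and> subst \<sigma> \<psi>)"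
| "subst \<sigma> (\<phi> \<^bold>\<or> \<psi>) = (subst \<sigma> \<phi> \<^bold>\<or> subst \<sigma> \<psi>)"
| "subst \<sigma> (\<phi> \<^bold>\<rightarrow> \<psi>) = (subst \<sigma> \<phi> \<^bold>\<rightarrow> subst \<sigma> \<psi>)"
| "subst \<sigma> (\<^bold>\<sim> \<phi>) = \<^bold>\<sim> (subst \<sigma> \<phi>)"

primrec msubst :: "(nat \<Rightarrow> mfm) \<Rightarrow> mfm \<Rightarrow> mfm" where
  "msubst \<sigma> (MVar x) = \<sigma> x"
| "msubst \<sigma> \<^bold>\<bottom>\<^sub>m = \<^bold>\<bottom>\<^sub>m"
| "msubst \<sigma> (\<phi> \<^bold>\<and>\<^sub>m \<psi>) = (msubst \<sigma> \<phi> \<^bold>\<and>\<^sub>m msubst \<sigma> \<psi>)"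
| "msubst \<sigma> (\<phi> \<^bold>\<or>\<^sub>m \<psi>) = (msubst \<sigma> \<phi> \<^bold>\<or>\<^sub>m msubst \<sigma> \<psi>)"
| "msubst \<sigma> (\<phi> \<^bold>\<rightarrow>\<^sub>m \<psi>) = (msubst \<sigma> \<phi> \<^bold>\<rightarrow>\<^sub>m msubst \<sigma> \<psi>)"
| "msubst \<sigma> (\<^bold>\<sim>\<^sub>m \<phi>) = \<^bold>\<sim>\<^sub>m (msubst \<sigma> \<phi>)"
| "msubst \<sigma> (\<^bold>\<box> \<phi>) = \<^bold>\<box> (msubst \<sigma> \<phi>)"
| "msubst \<sigma> (\<^bold>\<diamond> \<phi>) = \<^bold>\<diamond> (msubst \<sigma> \<phi>)"

primrec emb :: "fm \<Rightarrow> mfm" where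
  "emb (Var x) = MVar x"
| "emb \<^bold>\<bottom> = \<^bold>\<bottom>\<^sub>m"
| "emb (\<phi> \<^bold>\<and> \<psi>) = (emb \<phi> \<^bold>\<and>\<^sub>m emb \<psi>)"
| "emb (\<phi> \<^bold>\<or> \<psi>) = (emb \<phi> \<^bold>\<or>\<^sub>m emb \<psi>)"
| "emb (\<phi> \<^bold>\<rightarrow> \<psi>) = (emb \<phi> \<^bold>\<rightarrow>\<^sub>m emb \<psi>)"
| "emb (\<^bold>\<sim> \<phi>) = \<^bold>\<sim>\<^sub>m (emb \<phi>)"

primrec vars :: "fm \<Rightarrow> nat set" where
  "vars (Var x) = {x}"
| "vars \<^bold>\<bottom> = {}"
| "vars (\<phi> \<^bold>\<and> \<psi>) = vars \<phi> \<union> vars \<psi>"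
| "vars (\<phi> \<^bold>\<or> \<psi>) = vars \<phi> \<union> vars \<psi>"
| "vars (\<phi> \<^bold>\<rightarrow> \<psi>) = vars \<phi> \<union> vars \<psi>"
| "vars (\<^bold>\<sim> \<phi>) = vars \<phi>"

primrec sneg_free :: "fm \<Rightarrow> bool" where
  "sneg_free (Var x) = True"
| "sneg_free \<^bold>\<bottom> = True"
| "sneg_free (\<phi> \<^bold>\<and> \<psi>) = (sneg_free \<phi> \<and> sneg_free \<psi>)"
| "sneg_free (\<phi> \<^bold>\<or> \<psi>) = (sneg_free \<phi> \<and> sneg_free \<psi>)"
| "sneg_free (\<phi> \<^bold>\<rightarrow> \<psi>) = (sneg_free \<phi> \<and> sneg_free \<psi>)"
| "sneg_free (\<^bold>\<sim> \<phi>) = False"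

definition logic :: "fm set \<Rightarrow> bool" where
  "logic L \<longleftrightarrow>
     (\<forall>\<sigma> \<phi>. \<phi> \<in> L \<longrightarrow> subst \<sigma> \<phi> \<in> L) \<and>
     (\<forall>\<phi> \<psi>. \<phi> \<in> L \<longrightarrow> (\<phi> \<^bold>\<rightarrow> \<psi>) \<in> L \<longrightarrow> \<psi> \<in> L)"

definition mlogic :: "mfm set \<Rightarrow> bool" where
  "mlogic M \<longleftrightarrow>
     (\<forall>\<sigma> \<phi>. \<phi> \<in> M \<longrightarrow> msubst \<sigma> \<phi> \<in> M) \<and>
     (\<forall>\<phi> \<psi>. \<phi> \<in> M \<longrightarrow> (\<phi> \<^bold>\<rightarrow>\<^sub>m \<psi>) \<in> M \<longrightarrow> \<psi> \<in> M) \<and>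
     (\<forall>\<phi> \<psi>. (\<phi> \<^bold>\<rightarrow>\<^sub>m \<psi>) \<in> M \<longrightarrow> (\<^bold>\<box> \<phi> \<^bold>\<rightarrow>\<^sub>m \<^bold>\<box> \<psi>) \<in> M) \<and>
     (\<forall>\<phi> \<psi>. (\<phi> \<^bold>\<rightarrow>\<^sub>m \<psi>) \<in> M \<longrightarrow> (\<^bold>\<diamond> \<phi> \<^bold>\<rightarrow>\<^sub>m \<^bold>\<diamond> \<psi>) \<in> M)"

definition least_logic :: "fm set \<Rightarrow> fm set" where
  "least_logic X = \<Inter>{L. logic L \<and> X \<subseteq> L}"

definition least_mlogic :: "mfm set \<Rightarrow> mfm set" where
  "least_mlogic X = \<Inter>{M. mlogic M \<and> X \<subseteq> M}"

definition N4_axioms :: "fm set" where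
  "N4_axioms = (let p = Var 0; q = Var 1; r = Var 2 in {
     p \<^bold>\<rightarrow> (q \<^bold>\<rightarrow> p),
     (p \<^bold>\<rightarrow> (q \<^bold>\<rightarrow> r)) \<^bold>\<rightarrow> ((p \<^bold>\<rightarrow> q) \<^bold>\<rightarrow> (p \<^bold>\<rightarrow> r)),
     (p \<^bold>\<and> q) \<^bold>\<rightarrow> p,
     (p \<^bold>\<and> q) \<^bold>\<rightarrow> q,
     p \<^bold>\<rightarrow> (q \<^bold>\<rightarrow> (p \<^bold>\<and> q)),
     p \<^bold>\<rightarrow> (p \<^bold>\<or> q),
     q \<^bold>\<rightarrow> (p \<^bold>\<or> q),
     (p \<^bold>\<rightarrow> r) \<^bold>\<rightarrow> ((q \<^bold>\<rightarrow> r) \<^bold>\<rightarrow> ((p \<^bold>\<or> q) \<^bold>\<rightarrow> r)),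
     \<^bold>\<bottom> \<^bold>\<rightarrow> p,
     \<^bold>\<sim> (p \<^bold>\<or> q) \<^bold>\<leftrightarrow> (\<^bold>\<sim> p \<^bold>\<and> \<^bold>\<sim> q),
     \<^bold>\<sim> (p \<^bold>\<and> q) \<^bold>\<leftrightarrow> (\<^bold>\<sim> p \<^bold>\<or> \<^bold>\<sim> q),
     \<^bold>\<sim> (p \<^bold>\<rightarrow> q) \<^bold>\<leftrightarrow> (p \<^bold>\<and> \<^bold>\<sim> q),
     \<^bold>\<sim> (\<^bold>\<sim> p) \<^bold>\<leftrightarrow> p,
     \<^bold>\<sim> \<^bold>\<bottom>})"

definition N4bot :: "fm set" where
  "N4bot = least_logic N4_axioms"

definition BS4_axioms :: "mfm set" where
  "BS4_axioms = emb ` N4_axioms \<union> (let p = MVar 0; q = MVar 1 in {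
     p \<^bold>\<or>\<^sub>m \<^bold>\<not>\<^sub>m p,
     \<^bold>\<box> (p \<^bold>\<rightarrow>\<^sub>m p),
     (\<^bold>\<box> p \<^bold>\<and>\<^sub>m \<^bold>\<box> q) \<^bold>\<rightarrow>\<^sub>m \<^bold>\<box> (p \<^bold>\<and>\<^sub>m q),
     \<^bold>\<box> p \<^bold>\<rightarrow>\<^sub>m p,
     \<^bold>\<box> p \<^bold>\<rightarrow>\<^sub>m \<^bold>\<box> (\<^bold>\<box> p),
     \<^bold>\<not>\<^sub>m (\<^bold>\<box> p) \<^bold>\<leftrightarrow>\<^sub>m \<^bold>\<diamond> (\<^bold>\<not>\<^sub>m p),
     \<^bold>\<not>\<^sub>m (\<^bold>\<diamond> p) \<^bold>\<leftrightarrow>\<^sub>m \<^bold>\<box> (\<^bold>\<not>\<^sub>m p),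
     \<^bold>\<box> p \<^bold>\<Leftrightarrow>\<^sub>m \<^bold>\<sim>\<^sub>m (\<^bold>\<diamond> (\<^bold>\<sim>\<^sub>m p)),
     \<^bold>\<diamond> p \<^bold>\<Leftrightarrow>\<^sub>m \<^bold>\<sim>\<^sub>m (\<^bold>\<box> (\<^bold>\<sim>\<^sub>m p))})"

definition BS4 :: "mfm set" where
  "BS4 = least_mlogic BS4_axioms"

definition N4bot_extension :: "fm set \<Rightarrow> bool" where
  "N4bot_extension L \<longleftrightarrow> logic L \<and> N4bot \<subseteq> L"

definition BS4_extension :: "mfm set \<Rightarrow> bool" where
  "BS4_extension M \<longleftrightarrow> mlogic M \<and> BS4 \<subseteq> M"

definition logic_plus :: "fm set \<Rightarrow> fm set \<Rightarrow> fm set"  (infixl "\<oplus>" 65) where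
  "L \<oplus> X = least_logic (L \<union> X)"

definition mlogic_plus :: "mfm set \<Rightarrow> mfm set \<Rightarrow> mfm set"  (infixl "\<oplus>\<^sub>m" 65) where
  "M \<oplus>\<^sub>m X = least_mlogic (M \<union> X)"

fun TB :: "fm \<Rightarrow> mfm" where
  "TB (Var x) = \<^bold>\<box> (MVar x)"
| "TB \<^bold>\<bottom> = \<^bold>\<bottom>\<^sub>m"
| "TB (\<phi> \<^bold>\<and> \<psi>) = (TB \<phi> \<^bold>\<and>\<^sub>m TB \<psi>)"
| "TB (\<phi> \<^bold>\<or> \<psi>) = (TB \<phi> \<^bold>\<or>\<^sub>m TB \<psi>)"
| "TB (\<phi> \<^bold>\<rightarrow> \<psi>) = \<^bold>\<box> (TB \<phi> \<^bold>\<rightarrow>\<^sub>m TB \<psi>)"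
| "TB (\<^bold>\<sim> (Var x)) = \<^bold>\<box> (\<^bold>\<sim>\<^sub>m (MVar x))"
| "TB (\<^bold>\<sim> \<^bold>\<bottom>) = \<^bold>\<sim>\<^sub>m \<^bold>\<bottom>\<^sub>m"
| "TB (\<^bold>\<sim> (\<phi> \<^bold>\<and> \<psi>)) = (TB (\<^bold>\<sim> \<phi>) \<^bold>\<or>\<^sub>m TB (\<^bold>\<sim> \<psi>))"
| "TB (\<^bold>\<sim> (\<phi> \<^bold>\<or> \<psi>)) = (TB (\<^bold>\<sim> \<phi>) \<^bold>\<and>\<^sub>m TB (\<^bold>\<sim> \<psi>))"
| "TB (\<^bold>\<sim> (\<phi> \<^bold>\<rightarrow> \<psi>)) = (TB \<phi> \<^bold>\<and>\<^sub>m TB (\<^bold>\<sim> \<psi>))"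
| "TB (\<^bold>\<sim> (\<^bold>\<sim> \<phi>)) = TB \<phi>"

definition modal_companion :: "mfm set \<Rightarrow> fm set \<Rightarrow> bool" where
  "modal_companion M L \<longleftrightarrow> BS4_extension M \<and> (\<forall>\<phi>. \<phi> \<in> L \<longleftrightarrow> TB \<phi> \<in> M)"

definition tau_B :: "fm set \<Rightarrow> mfm set" where
  "tau_B L = BS4 \<oplus>\<^sub>m TB ` L"

text \<open>\<^term>\<open>P\<close> and \<^term>\<open>Q\<close> play the roles of \<open>{p\<^sub>1, \<dots>, p\<^sub>n}\<close> and \<open>{q\<^sub>1, \<dots>, q\<^sub>m}\<close>;
  both may be empty, and variables listed need not actually occur in \<^term>\<open>\<psi>\<close>.\<close>

definition special_form :: "fm \<Rightarrow> bool" where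
  "special_form \<chi> \<longleftrightarrow>
     (\<exists>\<psi> P Q. sneg_free \<psi> \<and> finite P \<and> finite Q \<and> P \<inter> Q = {} \<and> vars \<psi> \<subseteq> P \<union> Q \<and>
        \<chi> = subst (\<lambda>x. if x \<in> Q then Var x \<^bold>\<or> \<^bold>\<sim> (Var x) else Var x) \<psi>)"

end

theory Submission
  imports Defs
begin

text \<open>Only the implication from \<open>TB \<phi> \<in> tau_B L\<close> to \<open>\<phi> \<in> L\<close> needs an argument. Let \<open>W\<close> be the set
  of prime theories over \<open>L\<close>, ordered by inclusion, and write \<open>hat a\<close> for the set of prime theories
  containing \<open>a\<close>. The Boolean combinations of the sets \<open>hat a\<close> form a topological Boolean algebra
  whose interior operator \<open>box\<close> takes only values of the form \<open>hat a\<close>. Call a set \<open>hat c\<close> with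
  \<open>hat (\<sim>c) = {}\<close> designated. The designated sets form a filter containing every \<open>hat (a \<or> \<sim>a)\<close> and
  every dense \<open>hat a\<close>, and every \<open>box x \<union> box (W - x)\<close> is dense, since it contains all maximal theories.
  Hence the pairs \<open>(x, y)\<close> with \<open>box x \<union> box y\<close> designated form a twist structure that is a
  model of \<open>BS4\<close>. A formula \<open>TB (\<psi>(p, q \<or> \<sim>q))\<close> takes in it a value \<open>hat (\<psi>(a, c \<or> \<sim>c))\<close>,
  which is \<open>W\<close> when the axiom lies in \<open>L\<close>; so the model validates \<open>tau_B L\<close>. Under the canonical
  valuation \<open>TB \<phi>\<close> takes the value \<open>hat \<phi>\<close>, which is \<open>W\<close> only if \<open>\<phi> \<in> L\<close>.\<close>

section \<open>Extensions of \<open>N4bot\<close> and instances of their axioms\<close>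

locale n4_logic =
  fixes L :: "fm set"
  assumes logic_L: "logic L" and axioms_L: "N4_axioms \<subseteq> L"
begin

lemma L_subst: "\<phi> \<in> L \<Longrightarrow> subst \<sigma> \<phi> \<in> L"
  using logic_L unfolding logic_def by blast

lemma axiom_instances:
  "(a \<^bold>\<rightarrow> b \<^bold>\<rightarrow> a) \<in> L"
  "((a \<^bold>\<rightarrow> b \<^bold>\<rightarrow> c) \<^bold>\<rightarrow> (a \<^bold>\<rightarrow> b) \<^bold>\<rightarrow> a \<^bold>\<rightarrow> c) \<in> L"
  "(a \<^bold>\<and> b \<^bold>\<rightarrow> a) \<in> L"
  "(a \<^bold>\<and> b \<^bold>\<rightarrow> b) \<in> L"
  "(a \<^bold>\<rightarrow> b \<^bold>\<rightarrow> a \<^bold>\<and> b) \<in> L"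
  "(a \<^bold>\<rightarrow> a \<^bold>\<or> b) \<in> L"
  "(b \<^bold>\<rightarrow> a \<^bold>\<or> b) \<in> L"
  "((a \<^bold>\<rightarrow> c) \<^bold>\<rightarrow> (b \<^bold>\<rightarrow> c) \<^bold>\<rightarrow> a \<^bold>\<or> b \<^bold>\<rightarrow> c) \<in> L"
  "(\<^bold>\<bottom> \<^bold>\<rightarrow> a) \<in> L"
  "(\<^bold>\<sim> (a \<^bold>\<or> b) \<^bold>\<leftrightarrow> (\<^bold>\<sim> a \<^bold>\<and> \<^bold>\<sim> b)) \<in> L"
  "(\<^bold>\<sim> (a \<^bold>\<and> b) \<^bold>\<leftrightarrow> (\<^bold>\<sim> a \<^bold>\<or> \<^bold>\<sim> b)) \<in> L"
  "(\<^bold>\<sim> (a \<^bold>\<rightarrow> b) \<^bold>\<leftrightarrow> (a \<^bold>\<and> \<^bold>\<sim> b)) \<in> L"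
  "(\<^bold>\<sim> (\<^bold>\<sim> a) \<^bold>\<leftrightarrow> a) \<in> L"
  "\<^bold>\<sim> \<^bold>\<bottom> \<in> L"
proof -
  let ?\<sigma> = "\<lambda>i. if i = 0 then a else if i = 1 then b else c"
  have inst: "subst ?\<sigma> \<phi> \<in> L" if "\<phi> \<in> N4_axioms" for \<phi>
    using that axioms_L L_subst by blast
  show "(a \<^bold>\<rightarrow> b \<^bold>\<rightarrow> a) \<in> L"
    using inst[of "Var 0 \<^bold>\<rightarrow> Var 1 \<^bold>\<rightarrow> Var 0"] by (simp add: N4_axioms_def Let_def)
  show "((a \<^bold>\<rightarrow> b \<^bold>\<rightarrow> c) \<^bold>\<rightarrow> (a \<^bold>\<rightarrow> b) \<^bold>\<rightarrow> a \<^bold>\<rightarrow> c) \<in> L"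
    using inst[of "(Var 0 \<^bold>\<rightarrow> Var 1 \<^bold>\<rightarrow> Var 2) \<^bold>\<rightarrow> (Var 0 \<^bold>\<rightarrow> Var 1) \<^bold>\<rightarrow> Var 0 \<^bold>\<rightarrow> Var 2"] by (simp add: N4_axioms_def Let_def)
  show "(a \<^bold>\<and> b \<^bold>\<rightarrow> a) \<in> L"
    using inst[of "Var 0 \<^bold>\<and> Var 1 \<^bold>\<rightarrow> Var 0"] by (simp add: N4_axioms_def Let_def)
  show "(a \<^bold>\<and> b \<^bold>\<rightarrow> b) \<in> L"
    using inst[of "Var 0 \<^bold>\<and> Var 1 \<^bold>\<rightarrow> Var 1"] by (simp add: N4_axioms_def Let_def)
  show "(a \<^bold>\<rightarrow> b \<^bold>\<rightarrow> a \<^bold>\<and> b) \<in> L"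
    using inst[of "Var 0 \<^bold>\<rightarrow> Var 1 \<^bold>\<rightarrow> Var 0 \<^bold>\<and> Var 1"] by (simp add: N4_axioms_def Let_def)
  show "(a \<^bold>\<rightarrow> a \<^bold>\<or> b) \<in> L"
    using inst[of "Var 0 \<^bold>\<rightarrow> Var 0 \<^bold>\<or> Var 1"] by (simp add: N4_axioms_def Let_def)
  show "(b \<^bold>\<rightarrow> a \<^bold>\<or> b) \<in> L"
    using inst[of "Var 1 \<^bold>\<rightarrow> Var 0 \<^bold>\<or> Var 1"] by (simp add: N4_axioms_def Let_def)
  show "((a \<^bold>\<rightarrow> c) \<^bold>\<rightarrow> (b \<^bold>\<rightarrow> c) \<^bold>\<rightarrow> a \<^bold>\<or> b \<^bold>\<rightarrow> c) \<in> L"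
    using inst[of "(Var 0 \<^bold>\<rightarrow> Var 2) \<^bold>\<rightarrow> (Var 1 \<^bold>\<rightarrow> Var 2) \<^bold>\<rightarrow> Var 0 \<^bold>\<or> Var 1 \<^bold>\<rightarrow> Var 2"] by (simp add: N4_axioms_def Let_def)
  show "(\<^bold>\<bottom> \<^bold>\<rightarrow> a) \<in> L"
    using inst[of "\<^bold>\<bottom> \<^bold>\<rightarrow> Var 0"] by (simp add: N4_axioms_def Let_def)
  show "(\<^bold>\<sim> (a \<^bold>\<or> b) \<^bold>\<leftrightarrow> (\<^bold>\<sim> a \<^bold>\<and> \<^bold>\<sim> b)) \<in> L"
    using inst[of "\<^bold>\<sim> (Var 0 \<^bold>\<or> Var 1) \<^bold>\<leftrightarrow> (\<^bold>\<sim> (Var 0) \<^bold>\<and> \<^bold>\<sim> (Var 1))"] by (simp add: N4_axioms_def Let_def)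
  show "(\<^bold>\<sim> (a \<^bold>\<and> b) \<^bold>\<leftrightarrow> (\<^bold>\<sim> a \<^bold>\<or> \<^bold>\<sim> b)) \<in> L"
    using inst[of "\<^bold>\<sim> (Var 0 \<^bold>\<and> Var 1) \<^bold>\<leftrightarrow> (\<^bold>\<sim> (Var 0) \<^bold>\<or> \<^bold>\<sim> (Var 1))"] by (simp add: N4_axioms_def Let_def)
  show "(\<^bold>\<sim> (a \<^bold>\<rightarrow> b) \<^bold>\<leftrightarrow> (a \<^bold>\<and> \<^bold>\<sim> b)) \<in> L"
    using inst[of "\<^bold>\<sim> (Var 0 \<^bold>\<rightarrow> Var 1) \<^bold>\<leftrightarrow> (Var 0 \<^bold>\<and> \<^bold>\<sim> (Var 1))"] by (simp add: N4_axioms_def Let_def)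
  show "(\<^bold>\<sim> (\<^bold>\<sim> a) \<^bold>\<leftrightarrow> a) \<in> L"
    using inst[of "\<^bold>\<sim> (\<^bold>\<sim> (Var 0)) \<^bold>\<leftrightarrow> Var 0"] by (simp add: N4_axioms_def Let_def)
  show "\<^bold>\<sim> \<^bold>\<bottom> \<in> L"
    using inst[of "\<^bold>\<sim> \<^bold>\<bottom>"] by (simp add: N4_axioms_def Let_def)
qed

section \<open>Prime theories\<close>

definition theory_over :: "fm set \<Rightarrow> bool" where
  "theory_over T \<longleftrightarrow> L \<subseteq> T \<and> (\<forall>a b. a \<in> T \<longrightarrow> (a \<^bold>\<rightarrow> b) \<in> T \<longrightarrow> b \<in> T)"

lemma theory_over_L: "theory_over L"
  using logic_L unfolding theory_over_def logic_def by blast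

lemma theory_mp: "theory_over T \<Longrightarrow> (a \<^bold>\<rightarrow> b) \<in> T \<Longrightarrow> a \<in> T \<Longrightarrow> b \<in> T"
  unfolding theory_over_def by blast

lemma theory_L: "theory_over T \<Longrightarrow> a \<in> L \<Longrightarrow> a \<in> T"
  unfolding theory_over_def by blast

lemma theory_weaken: "theory_over T \<Longrightarrow> b \<in> T \<Longrightarrow> (a \<^bold>\<rightarrow> b) \<in> T"
  by (meson axiom_instances(1) theory_L theory_mp)

lemma theory_refl: "theory_over T \<Longrightarrow> (a \<^bold>\<rightarrow> a) \<in> T"
  by (meson axiom_instances(1,2) theory_L theory_mp)

lemma theory_con: "theory_over T \<Longrightarrow> (a \<^bold>\<and> b) \<in> T \<longleftrightarrow> a \<in> T \<and> b \<in> T"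
  by (meson axiom_instances(3,4,5) theory_L theory_mp)

text \<open>This set is the theory generated by \<open>T\<close> and \<open>a\<close>, so it stands
  in for a deduction theorem. Closure under modus ponens is the second implication axiom.\<close>

lemma theory_extend:
  assumes "theory_over T"
  shows "theory_over {b. (a \<^bold>\<rightarrow> b) \<in> T}"
  unfolding theory_over_def
proof (intro conjI allI impI subsetI; simp)
  show "(a \<^bold>\<rightarrow> b) \<in> T" if "b \<in> L" for b
    using that assms theory_L theory_weaken by blast
  show "(a \<^bold>\<rightarrow> c) \<in> T" if "(a \<^bold>\<rightarrow> b) \<in> T" "(a \<^bold>\<rightarrow> b \<^bold>\<rightarrow> c) \<in> T" for b c
    by (meson that assms axiom_instances(2) theory_L theory_mp)
qed

text \<open>Zorn's lemma, applied to the theories that contain \<open>T\<close> and omit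
  \<open>b\<close>. It is used both for an arbitrary \<open>b\<close>, to separate formulas, and for
  falsum, to reach maximal points.\<close>

lemma maximal_avoiding_theory:
  assumes "theory_over T" "b \<notin> T"
  obtains m where "theory_over m" "T \<subseteq> m" "b \<notin> m"
    "\<And>m'. theory_over m' \<Longrightarrow> m \<subseteq> m' \<Longrightarrow> b \<notin> m' \<Longrightarrow> m' = m"
proof -
  let ?A = "{m. theory_over m \<and> T \<subseteq> m \<and> b \<notin> m}"
  have "\<Union>C \<in> ?A" if "C \<noteq> {}" "subset.chain ?A C" for C
  proof -
    have C: "m \<in> ?A" if "m \<in> C" for m
      using that \<open>subset.chain ?A C\<close> by (auto simp: subset_chain_def)
    \<comment> \<open>The two premises may come from different members of the chain, but both lie in
      the larger one.\<close>
    have "d \<in> \<Union>C" if cd: "c \<in> \<Union>C" "(c \<^bold>\<rightarrow> d) \<in> \<Union>C" for c d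
    proof -
      obtain m1 m2 where m: "m1 \<in> C" "c \<in> m1" "m2 \<in> C" "(c \<^bold>\<rightarrow> d) \<in> m2"
        using cd by blast
      then have "m1 \<subseteq> m2 \<or> m2 \<subseteq> m1"
        using \<open>subset.chain ?A C\<close> by (auto simp: subset_chain_def)
      then show ?thesis
        using m C theory_mp by (metis (no_types, lifting) Union_iff mem_Collect_eq subsetD)
    qed
    moreover have "L \<subseteq> \<Union>C" "T \<subseteq> \<Union>C" "b \<notin> \<Union>C"
      using C \<open>C \<noteq> {}\<close> by (fastforce simp: theory_over_def)+
    ultimately show ?thesis
      unfolding theory_over_def by blast
  qed
  then obtain m where "m \<in> ?A" "\<forall>m'\<in>?A. m \<subseteq> m' \<longrightarrow> m' = m"
    using subset_Zorn_nonempty[of ?A] assms by auto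
  then show thesis
    by (intro that[of m]) auto
qed

definition W :: "fm set set" where
  "W = {w. theory_over w \<and> \<^bold>\<bottom> \<notin> w \<and> (\<forall>a b. (a \<^bold>\<or> b) \<in> w \<longrightarrow> a \<in> w \<or> b \<in> w)}"

lemma W_theory: "w \<in> W \<Longrightarrow> theory_over w"
  by (simp add: W_def)

text \<open>If \<open>c\<close> is not in \<open>m\<close>, the theory generated by \<open>m\<close>
  and \<open>c\<close> is strictly larger, so it contains \<open>b\<close>, that is,
  \<open>c \<rightarrow> b\<close> is in \<open>m\<close>. If both disjuncts were missing, the
  disjunction would yield \<open>b\<close>; falsum would yield \<open>b\<close> as well.\<close>

lemma maximal_avoiding_prime:
  assumes m: "theory_over m" "b \<notin> m"
    and max: "\<And>m'. theory_over m' \<Longrightarrow> m \<subseteq> m' \<Longrightarrow> b \<notin> m' \<Longrightarrow> m' = m"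
  shows "m \<in> W"
proof -
  have imp: "(c \<^bold>\<rightarrow> b) \<in> m" if "c \<notin> m" for c
  proof (rule ccontr)
    assume "(c \<^bold>\<rightarrow> b) \<notin> m"
    then have "{d. (c \<^bold>\<rightarrow> d) \<in> m} = m"
      using m theory_weaken by (intro max theory_extend) auto
    then show False
      using that theory_refl[OF m(1)] by blast
  qed
  have "c \<in> m \<or> d \<in> m" if "(c \<^bold>\<or> d) \<in> m" for c d
    using that imp m by (meson axiom_instances(8) theory_L theory_mp)
  moreover have "\<^bold>\<bottom> \<notin> m"
    using m by (meson axiom_instances(9) theory_L theory_mp)
  ultimately show ?thesis
    using m by (simp add: W_def)
qed

lemma prime_extension:
  assumes "theory_over T" "b \<notin> T"
  obtains w where "w \<in> W" "T \<subseteq> w" "b \<notin> w"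
proof -
  obtain m where "theory_over m" "T \<subseteq> m" "b \<notin> m"
      "\<And>m'. theory_over m' \<Longrightarrow> m \<subseteq> m' \<Longrightarrow> b \<notin> m' \<Longrightarrow> m' = m"
    using maximal_avoiding_theory[OF assms] by metis
  then show thesis
    using maximal_avoiding_prime that by metis
qed

text \<open>A theory maximal among those omitting falsum is prime. All members of \<open>W\<close>
  omit falsum, so it is also maximal in \<open>W\<close>.\<close>

lemma maximal_extension:
  assumes "w \<in> W"
  obtains m where "m \<in> W" "w \<subseteq> m" "\<And>m'. m' \<in> W \<Longrightarrow> m \<subseteq> m' \<Longrightarrow> m' = m"
proof -
  have "theory_over w" "\<^bold>\<bottom> \<notin> w"
    using assms by (auto simp: W_def)
  then obtain m where m: "theory_over m" "w \<subseteq> m" "\<^bold>\<bottom> \<notin> m"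
      "\<And>m'. theory_over m' \<Longrightarrow> m \<subseteq> m' \<Longrightarrow> \<^bold>\<bottom> \<notin> m' \<Longrightarrow> m' = m"
    using maximal_avoiding_theory by metis
  have "m \<in> W"
    using maximal_avoiding_prime m by metis
  then show thesis
    using that m by (simp add: W_def)
qed

section \<open>The topological Boolean algebra of prime theories\<close>

definition hat :: "fm \<Rightarrow> fm set set" where
  "hat a = {w \<in> W. a \<in> w}"

text \<open>The interior operator for the topology on \<open>W\<close> whose open sets are closed
  upwards under inclusion.\<close>

definition box :: "fm set set \<Rightarrow> fm set set" where
  "box x = {w \<in> W. \<forall>w'\<in>W. w \<subseteq> w' \<longrightarrow> w' \<in> x}"

lemma hat_subset: "hat a \<subseteq> W"
  by (auto simp: hat_def)

lemma hat_L: "a \<in> L \<Longrightarrow> hat a = W"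
  by (auto simp: hat_def W_theory theory_L)

lemma L_if_hat: "hat a = W \<Longrightarrow> a \<in> L"
  using prime_extension[OF theory_over_L, of a] unfolding hat_def by blast

lemma hat_bot [simp]: "hat \<^bold>\<bottom> = {}"
  by (auto simp: hat_def W_def)

lemma hat_con [simp]: "hat (a \<^bold>\<and> b) = hat a \<inter> hat b"
  by (auto simp: hat_def W_theory theory_con)

lemma hat_dis [simp]: "hat (a \<^bold>\<or> b) = hat a \<union> hat b"
proof -
  have "(a \<^bold>\<or> b) \<in> w \<longleftrightarrow> a \<in> w \<or> b \<in> w" if "w \<in> W" for w
  proof -
    have "theory_over w"
      using that W_theory by simp
    then have "a \<in> w \<or> b \<in> w \<Longrightarrow> (a \<^bold>\<or> b) \<in> w"
      by (meson axiom_instances(6,7) theory_L theory_mp)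
    then show ?thesis
      using that by (auto simp: W_def)
  qed
  then show ?thesis
    by (auto simp: hat_def)
qed

lemma hat_imp [simp]: "hat (a \<^bold>\<rightarrow> b) = box ((W - hat a) \<union> hat b)"
proof -
  have "(a \<^bold>\<rightarrow> b) \<in> w" if w: "w \<in> W" and *: "\<And>w'. w' \<in> W \<Longrightarrow> w \<subseteq> w' \<Longrightarrow> a \<in> w' \<Longrightarrow> b \<in> w'" for w
  proof (rule ccontr)
    assume "(a \<^bold>\<rightarrow> b) \<notin> w"
    \<comment> \<open>The theory generated by \<open>w\<close> and \<open>a\<close> omits
      \<open>b\<close>; any prime extension of it omitting \<open>b\<close> contradicts the
      assumption on the points above \<open>w\<close>.\<close>
    then obtain w' where "w' \<in> W" "{c. (a \<^bold>\<rightarrow> c) \<in> w} \<subseteq> w'" "b \<notin> w'"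
      using prime_extension[OF theory_extend[OF W_theory[OF w]]] by (metis mem_Collect_eq)
    then show False
      using * W_theory[OF w] theory_weaken theory_refl by blast
  qed
  moreover have "b \<in> w'" if "w \<in> W" "w' \<in> W" "w \<subseteq> w'" "(a \<^bold>\<rightarrow> b) \<in> w" "a \<in> w'" for w w'
    using that W_theory theory_mp by blast
  ultimately have "(a \<^bold>\<rightarrow> b) \<in> w \<longleftrightarrow> (\<forall>w'\<in>W. w \<subseteq> w' \<longrightarrow> a \<in> w' \<longrightarrow> b \<in> w')"
    if "w \<in> W" for w
    using that by metis
  then show ?thesis
    by (auto simp: hat_def box_def)
qed

lemma hat_eq_if_iff:
  assumes "(a \<^bold>\<leftrightarrow> b) \<in> L"
  shows "hat a = hat b"
proof -
  have "a \<in> w \<longleftrightarrow> b \<in> w" if "w \<in> W" for w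
    using W_theory[OF that] theory_L[OF W_theory[OF that] assms] theory_con theory_mp by blast
  then show ?thesis
    by (auto simp: hat_def)
qed

lemma hat_sneg [simp]:
  "hat (\<^bold>\<sim> (a \<^bold>\<or> b)) = hat (\<^bold>\<sim> a) \<inter> hat (\<^bold>\<sim> b)"
  "hat (\<^bold>\<sim> (a \<^bold>\<and> b)) = hat (\<^bold>\<sim> a) \<union> hat (\<^bold>\<sim> b)"
  "hat (\<^bold>\<sim> (a \<^bold>\<rightarrow> b)) = hat a \<inter> hat (\<^bold>\<sim> b)"
  "hat (\<^bold>\<sim> (\<^bold>\<sim> a)) = hat a"
  "hat (\<^bold>\<sim> \<^bold>\<bottom>) = W"
  using hat_eq_if_iff[OF axiom_instances(10)] hat_eq_if_iff[OF axiom_instances(11)]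
    hat_eq_if_iff[OF axiom_instances(12)] hat_eq_if_iff[OF axiom_instances(13)]
    hat_L[OF axiom_instances(14)]
  by simp_all

lemma box_subset_W: "box x \<subseteq> W"
  by (auto simp: box_def)

lemma box_subset: "box x \<subseteq> x"
  by (auto simp: box_def)

lemma box_mono: "x \<subseteq> y \<Longrightarrow> box x \<subseteq> box y"
  by (auto simp: box_def)

lemma box_Int: "box (x \<inter> y) = box x \<inter> box y"
  by (auto simp: box_def)

lemma box_box [simp]: "box (box x) = box x"
  by (auto simp: box_def)

lemma box_W [simp]: "box W = W"
  by (auto simp: box_def)

lemma box_W_Un: "box (W \<union> x) = W"
  by (auto simp: box_def)

lemma box_hat [simp]: "box (hat a) = hat a"
  by (auto simp: box_def hat_def)

text \<open>Sets in conjunctive normal form; the clauses have this shape because \<open>box\<close> turns such a clause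
  into \<open>hat (a \<rightarrow> b)\<close>.\<close>

inductive_set cnf :: "fm set set set" where
  clause: "(W - hat a) \<union> hat b \<in> cnf"
| Int: "x \<in> cnf \<Longrightarrow> y \<in> cnf \<Longrightarrow> x \<inter> y \<in> cnf"

lemma cnf_subset: "x \<in> cnf \<Longrightarrow> x \<subseteq> W"
  by (induction rule: cnf.induct) (use hat_subset in auto)

lemma cnf_hat: "hat a \<in> cnf"
  using cnf.clause[of "\<^bold>\<sim> \<^bold>\<bottom>" a] by simp

lemma cnf_Compl_hat: "W - hat a \<in> cnf"
  using cnf.clause[of a "\<^bold>\<bottom>"] by simp

text \<open>By distributivity it suffices to join two clauses, and these merge into a single
  clause.\<close>

lemma cnf_Un:
  assumes "x \<in> cnf" "y \<in> cnf"
  shows "x \<union> y \<in> cnf"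
  using assms(1)
proof (induction rule: cnf.induct)
  case (clause a b)
  from assms(2) show ?case
  proof (induction rule: cnf.induct)
    case (clause c d)
    have "((W - hat a) \<union> hat b) \<union> ((W - hat c) \<union> hat d) = (W - hat (a \<^bold>\<and> c)) \<union> hat (b \<^bold>\<or> d)"
      by auto
    then show ?case
      using cnf.clause by metis
  next
    case (Int x y)
    then show ?case
      using cnf.Int by (simp add: Un_Int_distrib)
  qed
next
  case (Int x y)
  then show ?case
    using cnf.Int by (simp add: Un_Int_distrib2)
qed

lemma cnf_Compl:
  assumes "x \<in> cnf"
  shows "W - x \<in> cnf"
  using assms
proof (induction rule: cnf.induct)
  case (clause a b)
  have "W - ((W - hat a) \<union> hat b) = hat a \<inter> (W - hat b)"
    using hat_subset by auto
  then show ?case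
    using cnf.Int cnf_hat cnf_Compl_hat by simp
next
  case (Int x y)
  then show ?case
    using cnf_Un by (simp add: Diff_Int)
qed

text \<open>\<open>box\<close> commutes with intersections, and a clause becomes the value of an
  implication, so the interior of a Boolean combination is again the value of one formula.\<close>

lemma box_cnf:
  assumes "x \<in> cnf"
  obtains a where "box x = hat a"
proof -
  from assms have "\<exists>a. box x = hat a"
  proof (induction rule: cnf.induct)
    case (clause a b)
    then show ?case
      by (intro exI[of _ "a \<^bold>\<rightarrow> b"]) simp
  next
    case (Int x y)
    then show ?case
      by (metis box_Int hat_con)
  qed
  then show thesis
    using that by blast
qed

lemma cnf_box: "x \<in> cnf \<Longrightarrow> box x \<in> cnf"
  by (metis box_cnf cnf_hat)

section \<open>Designated sets\<close>

text \<open>These are exactly the sets \<open>hat (c \<or> \<sim>c)\<close>, the values that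
  instances of \<open>q \<or> \<sim>q\<close> can take.\<close>

definition designated :: "fm set set \<Rightarrow> bool" where
  "designated x \<longleftrightarrow> (\<exists>c. x = hat c \<and> hat (\<^bold>\<sim> c) = {})"

lemma designated_Int: "designated x \<Longrightarrow> designated y \<Longrightarrow> designated (x \<inter> y)"
  unfolding designated_def by (metis Un_empty hat_con hat_sneg(2))

lemma designated_mono:
  assumes "designated x" "x \<subseteq> hat a"
  shows "designated (hat a)"
proof -
  obtain c where "x = hat c" "hat (\<^bold>\<sim> c) = {}"
    using assms by (auto simp: designated_def)
  then show ?thesis
    unfolding designated_def using assms hat_subset[of a]
    \<comment> \<open>By the law for negated implications,
      \<open>\<sim>(a \<rightarrow> \<bottom>)\<close> has the same value as \<open>a\<close>, while
      its strong negation has the value of \<open>a \<rightarrow> \<bottom>\<close>. Joining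
      \<open>c\<close> leaves the value at \<open>hat a\<close> and makes that of the strong
      negation empty.\<close>
    by (intro exI[of _ "\<^bold>\<sim> (a \<^bold>\<rightarrow> \<^bold>\<bottom>) \<^bold>\<or> c"]) auto
qed

text \<open>The same reformulation of \<open>a\<close> works without a second disjunct: the strong
  negation takes the value \<open>box (W - hat a)\<close>, empty by density.\<close>

lemma designated_dense:
  assumes "box (W - hat a) = {}"
  shows "designated (hat a)"
  unfolding designated_def using assms hat_subset[of a]
  by (intro exI[of _ "\<^bold>\<sim> (a \<^bold>\<rightarrow> \<^bold>\<bottom>)"]) auto

text \<open>The formula \<open>a \<or> \<sim>a\<close> is no witness itself: its strong negation
  holds wherever both \<open>a\<close> and \<open>\<sim>a\<close> do. The first disjunct of the
  witness confines the strong negation to points outside \<open>hat (\<sim>a)\<close>, the second to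
  points inside.\<close>

lemma designated_hat_sneg: "designated (hat a \<union> hat (\<^bold>\<sim> a))"
  unfolding designated_def using hat_subset[of a] hat_subset[of "\<^bold>\<sim> a"]
    box_subset[of "W - (hat a \<union> hat (\<^bold>\<sim> a))"]
  by (intro exI[of _ "\<^bold>\<sim> ((a \<^bold>\<or> \<^bold>\<sim> a) \<^bold>\<rightarrow> \<^bold>\<bottom>) \<^bold>\<or> a"]) auto

lemma designated_box_Compl:
  assumes "x \<in> cnf"
  shows "designated (box x \<union> box (W - x))"
proof -
  obtain a b where ab: "box x = hat a" "box (W - x) = hat b"
    using box_cnf assms cnf_Compl by metis
  have "w \<notin> box (W - (box x \<union> box (W - x)))" for w
  proof
    assume w: "w \<in> box (W - (box x \<union> box (W - x)))"
    then have "w \<in> W"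
      using box_subset_W by blast
    then obtain m where m: "m \<in> W" "w \<subseteq> m" "\<And>m'. m' \<in> W \<Longrightarrow> m \<subseteq> m' \<Longrightarrow> m' = m"
      by (rule maximal_extension) blast
    \<comment> \<open>The only point of \<open>W\<close> above \<open>m\<close> is \<open>m\<close>
      itself, so at \<open>m\<close> membership in a set and in its interior coincide.\<close>
    then have "m \<in> box x \<union> box (W - x)"
      unfolding box_def by (cases "m \<in> x") (simp_all, metis+)
    then show False
      using w m(1,2) by (auto simp: box_def[of "W - (_ \<union> _)"])
  qed
  then have "designated (hat (a \<^bold>\<or> b))"
    by (intro designated_dense) (auto simp: ab)
  then show ?thesis
    by (simp add: ab)
qed

section \<open>The twist structure\<close>

text \<open>The coordinates collect the points verifying a formula and its strong negation.
  Interiors occur in the condition because \<open>TB (q \<or> \<sim>q)\<close> takes the value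
  \<open>box x \<union> box y\<close>, which is thereby forced to be some
  \<open>hat (c \<or> \<sim>c)\<close>.\<close>

definition twist :: "(fm set set \<times> fm set set) set" where
  "twist = {(x, y). x \<in> cnf \<and> y \<in> cnf \<and> designated (box x \<union> box y)}"

text \<open>First coordinates are evaluated classically, with \<open>box\<close> as interior; second
  coordinates follow the laws of strong negation. Hence \<open>Box\<close> takes a closure, and
  \<open>Dia\<close> an interior, in the second coordinate.\<close>

primrec mval :: "(nat \<Rightarrow> fm set set \<times> fm set set) \<Rightarrow> mfm \<Rightarrow> fm set set \<times> fm set set" where
  "mval v (MVar i) = v i"
| "mval v \<^bold>\<bottom>\<^sub>m = ({}, W)"
| "mval v (\<phi> \<^bold>\<and>\<^sub>m \<psi>) =
    (fst (mval v \<phi>) \<inter> fst (mval v \<psi>), snd (mval v \<phi>) \<union> snd (mval v \<psi>))"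
| "mval v (\<phi> \<^bold>\<or>\<^sub>m \<psi>) =
    (fst (mval v \<phi>) \<union> fst (mval v \<psi>), snd (mval v \<phi>) \<inter> snd (mval v \<psi>))"
| "mval v (\<phi> \<^bold>\<rightarrow>\<^sub>m \<psi>) =
    ((W - fst (mval v \<phi>)) \<union> fst (mval v \<psi>), fst (mval v \<phi>) \<inter> snd (mval v \<psi>))"
| "mval v (\<^bold>\<sim>\<^sub>m \<phi>) = (snd (mval v \<phi>), fst (mval v \<phi>))"
| "mval v (\<^bold>\<box> \<phi>) = (box (fst (mval v \<phi>)), W - box (W - snd (mval v \<phi>)))"
| "mval v (\<^bold>\<diamond> \<phi>) = (W - box (W - fst (mval v \<phi>)), box (snd (mval v \<phi>)))"

text \<open>\<open>box x \<union> box y\<close> is the value of a disjunction, so it inherits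
  designation from any designated subset.\<close>

lemma twistI:
  assumes "x \<in> cnf" "y \<in> cnf" "designated d" "d \<subseteq> box x \<union> box y"
  shows "(x, y) \<in> twist"
proof -
  obtain a b where ab: "box x = hat a" "box y = hat b"
    using box_cnf assms by metis
  then have "designated (hat (a \<^bold>\<or> b))"
    using assms by (intro designated_mono[of d]) auto
  then show ?thesis
    using assms ab by (simp add: twist_def)
qed

lemma twist_swap: "(x, y) \<in> twist \<Longrightarrow> (y, x) \<in> twist"
  by (simp add: twist_def Un_commute)

lemma twist_bot: "({}, W) \<in> twist"
proof (rule twistI)
  show "{} \<in> cnf" "W \<in> cnf"
    using cnf_hat[of "\<^bold>\<bottom>"] cnf_hat[of "\<^bold>\<sim> \<^bold>\<bottom>"] by simp_all
  show "designated W"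
    unfolding designated_def by (intro exI[of _ "\<^bold>\<sim> \<^bold>\<bottom>"]) simp
  show "W \<subseteq> box {} \<union> box W"
    by simp
qed

lemma twist_con:
  assumes "(x, y) \<in> twist" "(x', y') \<in> twist"
  shows "(x \<inter> x', y \<union> y') \<in> twist"
proof (rule twistI)
  show "x \<inter> x' \<in> cnf" "y \<union> y' \<in> cnf"
    using assms cnf.Int cnf_Un by (auto simp: twist_def)
  show "designated ((box x \<union> box y) \<inter> (box x' \<union> box y'))"
    using assms designated_Int by (auto simp: twist_def)
  show "(box x \<union> box y) \<inter> (box x' \<union> box y') \<subseteq> box (x \<inter> x') \<union> box (y \<union> y')"
    using box_mono[of y "y \<union> y'"] box_mono[of y' "y \<union> y'"] by (auto simp: box_Int)
qed

text \<open>Boolean complements need not respect designation by themselves;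
  \<open>designated_box_Compl\<close> supplies the factor \<open>box x \<union> box (W - x)\<close>.
  On \<open>box (W - x)\<close> the implication holds in the interior, and on \<open>box x\<close>
  the condition on the second pair decides.\<close>

lemma twist_imp:
  assumes "(x, y) \<in> twist" "(x', y') \<in> twist"
  shows "((W - x) \<union> x', x \<inter> y') \<in> twist"
proof (rule twistI)
  show "(W - x) \<union> x' \<in> cnf" "x \<inter> y' \<in> cnf"
    using assms cnf.Int cnf_Un cnf_Compl by (auto simp: twist_def)
  show "designated ((box x \<union> box (W - x)) \<inter> (box x' \<union> box y'))"
    using assms designated_Int designated_box_Compl by (auto simp: twist_def)
  show "(box x \<union> box (W - x)) \<inter> (box x' \<union> box y') \<subseteq> box ((W - x) \<union> x') \<union> box (x \<inter> y')"
    using box_mono[of "W - x" "(W - x) \<union> x'"] box_mono[of x' "(W - x) \<union> x'"]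
    by (auto simp: box_Int)
qed

text \<open>\<open>box x\<close> is open and lies inside \<open>W - box (W - x)\<close>, the closure
  of \<open>x\<close>.\<close>

lemma box_subset_box_dia: "box x \<subseteq> box (W - box (W - x))"
  using box_mono[of "box x" "W - box (W - x)"] box_subset[of x] box_subset[of "W - x"]
    box_subset_W[of x] by auto

lemma twist_box:
  assumes "(x, y) \<in> twist"
  shows "(box x, W - box (W - y)) \<in> twist"
proof (rule twistI)
  show "box x \<in> cnf" "W - box (W - y) \<in> cnf"
    using assms cnf_box cnf_Compl by (auto simp: twist_def)
  show "designated (box x \<union> box y)"
    using assms by (simp add: twist_def)
  show "box x \<union> box y \<subseteq> box (box x) \<union> box (W - box (W - y))"
    using box_subset_box_dia by auto
qed

lemma mval_twist:
  assumes "\<And>i. v i \<in> twist"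
  shows "mval v \<phi> \<in> twist"
proof (induction \<phi>)
  case (MVar i)
  then show ?case using assms by simp
next
  case MBot
  then show ?case using twist_bot by simp
next
  case (MCon \<phi> \<psi>)
  then show ?case using twist_con by simp
next
  case (MDis \<phi> \<psi>)
  then show ?case
    \<comment> \<open>Disjunction is conjunction with the two coordinates exchanged;
      \<open>Dia\<close> is obtained from \<open>Box\<close> in the same way.\<close>
    using twist_swap[OF twist_con[OF twist_swap twist_swap]] by simp
next
  case (MImp \<phi> \<psi>)
  then show ?case by simp (metis prod.collapse twist_imp)
next
  case (MSNeg \<phi>)
  then show ?case using twist_swap by simp
next
  case (Box \<phi>)
  then show ?case using twist_box by simp
next
  case (Dia \<phi>)
  then show ?case using twist_swap[OF twist_box[OF twist_swap]] by simp
qed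

lemma mval_subset:
  assumes "\<And>i. v i \<in> twist"
  shows "fst (mval v \<phi>) \<subseteq> W" "snd (mval v \<phi>) \<subseteq> W"
  using mval_twist[of v \<phi>, OF assms] cnf_subset by (simp_all add: twist_def case_prod_beta)

lemma mval_msubst: "mval v (msubst \<sigma> \<phi>) = mval (\<lambda>i. mval v (\<sigma> i)) \<phi>"
  by (induction \<phi>) simp_all

definition valid :: "mfm set" where
  "valid = {\<phi>. \<forall>v. (\<forall>i. v i \<in> twist) \<longrightarrow> fst (mval v \<phi>) = W}"

lemma valid_imp_iff:
  "(\<phi> \<^bold>\<rightarrow>\<^sub>m \<psi>) \<in> valid \<longleftrightarrow>
    (\<forall>v. (\<forall>i. v i \<in> twist) \<longrightarrow> fst (mval v \<phi>) \<subseteq> fst (mval v \<psi>))"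
proof -
  have "(W - fst (mval v \<phi>)) \<union> fst (mval v \<psi>) = W \<longleftrightarrow> fst (mval v \<phi>) \<subseteq> fst (mval v \<psi>)"
    if "\<forall>i. v i \<in> twist" for v
    using mval_subset(1)[of v \<phi>] mval_subset(1)[of v \<psi>] that by auto
  then show ?thesis
    unfolding valid_def by auto
qed

lemma valid_con_iff: "(\<phi> \<^bold>\<and>\<^sub>m \<psi>) \<in> valid \<longleftrightarrow> \<phi> \<in> valid \<and> \<psi> \<in> valid"
proof -
  have "fst (mval v \<phi>) \<inter> fst (mval v \<psi>) = W \<longleftrightarrow> fst (mval v \<phi>) = W \<and> fst (mval v \<psi>) = W"
    if "\<forall>i. v i \<in> twist" for v
    using mval_subset(1)[of v \<phi>] mval_subset(1)[of v \<psi>] that by auto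
  then show ?thesis
    unfolding valid_def by auto
qed

lemma mlogic_valid: "mlogic valid"
  unfolding mlogic_def
proof (intro conjI allI impI)
  fix \<sigma> \<phi> assume "\<phi> \<in> valid"
  then show "msubst \<sigma> \<phi> \<in> valid"
    by (simp add: valid_def mval_msubst mval_twist)
next
  fix \<phi> \<psi> assume "\<phi> \<in> valid" "(\<phi> \<^bold>\<rightarrow>\<^sub>m \<psi>) \<in> valid"
  then show "\<psi> \<in> valid"
    using mval_subset(1) unfolding valid_imp_iff by (fastforce simp: valid_def)
next
  fix \<phi> \<psi> assume "(\<phi> \<^bold>\<rightarrow>\<^sub>m \<psi>) \<in> valid"
  then show "(\<^bold>\<box> \<phi> \<^bold>\<rightarrow>\<^sub>m \<^bold>\<box> \<psi>) \<in> valid"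
    unfolding valid_imp_iff by (simp add: box_mono)
next
  fix \<phi> \<psi> assume "(\<phi> \<^bold>\<rightarrow>\<^sub>m \<psi>) \<in> valid"
  then show "(\<^bold>\<diamond> \<phi> \<^bold>\<rightarrow>\<^sub>m \<^bold>\<diamond> \<psi>) \<in> valid"
    unfolding valid_imp_iff by (simp add: box_mono Diff_mono)
qed

lemma BS4_axioms_valid: "BS4_axioms \<subseteq> valid"
proof -
  have W: "fst (v i) \<subseteq> W" "snd (v i) \<subseteq> W" if "\<forall>i. v i \<in> twist" for v and i :: nat
    using mval_subset[of v "MVar i"] that by auto
  have Compl: "W - (W - fst (v i)) = fst (v i)" if "\<forall>i. v i \<in> twist" for v and i :: nat
    using W[OF that] by auto
  have "emb ` N4_axioms \<subseteq> valid"
    unfolding N4_axioms_def Let_def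
    by (simp add: valid_con_iff valid_imp_iff, simp add: valid_def)
      (intro conjI allI impI; drule W(1)[where i = 0]; blast)
  moreover have "(MVar 0 \<^bold>\<or>\<^sub>m \<^bold>\<not>\<^sub>m (MVar 0)) \<in> valid" "\<^bold>\<box> (MVar 0 \<^bold>\<rightarrow>\<^sub>m MVar 0) \<in> valid"
    using W by (auto simp: valid_def Un_absorb2)
  moreover have "(\<^bold>\<box> (MVar 0) \<^bold>\<and>\<^sub>m \<^bold>\<box> (MVar 1) \<^bold>\<rightarrow>\<^sub>m \<^bold>\<box> (MVar 0 \<^bold>\<and>\<^sub>m MVar 1)) \<in> valid"
    "(\<^bold>\<box> (MVar 0) \<^bold>\<rightarrow>\<^sub>m MVar 0) \<in> valid"
    "(\<^bold>\<box> (MVar 0) \<^bold>\<rightarrow>\<^sub>m \<^bold>\<box> (\<^bold>\<box> (MVar 0))) \<in> valid"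
    "(\<^bold>\<not>\<^sub>m (\<^bold>\<box> (MVar 0)) \<^bold>\<leftrightarrow>\<^sub>m \<^bold>\<diamond> (\<^bold>\<not>\<^sub>m (MVar 0))) \<in> valid"
    "(\<^bold>\<not>\<^sub>m (\<^bold>\<diamond> (MVar 0)) \<^bold>\<leftrightarrow>\<^sub>m \<^bold>\<box> (\<^bold>\<not>\<^sub>m (MVar 0))) \<in> valid"
    "(\<^bold>\<box> (MVar 0) \<^bold>\<Leftrightarrow>\<^sub>m \<^bold>\<sim>\<^sub>m (\<^bold>\<diamond> (\<^bold>\<sim>\<^sub>m (MVar 0)))) \<in> valid"
    "(\<^bold>\<diamond> (MVar 0) \<^bold>\<Leftrightarrow>\<^sub>m \<^bold>\<sim>\<^sub>m (\<^bold>\<box> (\<^bold>\<sim>\<^sub>m (MVar 0)))) \<in> valid"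
    by (simp_all add: valid_con_iff valid_imp_iff box_Int box_subset Compl double_diff box_subset_W)
  ultimately show ?thesis
    unfolding BS4_axioms_def Let_def by simp
qed

section \<open>Translated formulas in the twist structure\<close>

abbreviation tval :: "(nat \<Rightarrow> fm set set \<times> fm set set) \<Rightarrow> fm \<Rightarrow> fm set set" where
  "tval v \<phi> \<equiv> fst (mval v (TB \<phi>))"

text \<open>Variables and negated variables are translated under a box, so \<open>box_cnf\<close>
  applies; every other clause combines values \<open>hat a\<close> as a connective does.\<close>

lemma tval_hat:
  assumes "\<And>i. v i \<in> twist"
  shows "\<exists>a. tval v \<phi> = hat a"
proof (induction \<phi> rule: TB.induct)
  case (1 i)
  then show ?case
    using assms[of i] by (simp add: twist_def case_prod_beta) (metis box_cnf)
next
  case 2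
  then show ?case by clarsimp (metis hat_bot)
next
  case (3 \<phi> \<psi>)
  then show ?case by clarsimp (metis hat_con)
next
  case (4 \<phi> \<psi>)
  then show ?case by clarsimp (metis hat_dis)
next
  case (5 \<phi> \<psi>)
  then show ?case
    by clarsimp (metis hat_imp)
next
  case (6 i)
  then show ?case
    using assms[of i] by (simp add: twist_def case_prod_beta) (metis box_cnf)
next
  case 7
  then show ?case by clarsimp (metis hat_sneg(5))
next
  case (8 \<phi> \<psi>)
  then show ?case by clarsimp (metis hat_dis)
next
  case (9 \<phi> \<psi>)
  then show ?case by clarsimp (metis hat_con)
next
  case (10 \<phi> \<psi>)
  then show ?case by clarsimp (metis hat_con)
next
  case (11 \<phi>)
  then show ?case by simp
qed

lemma box_tval:
  assumes "\<And>i. v i \<in> twist"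
  shows "box (tval v \<phi>) = tval v \<phi>"
proof -
  obtain a where "tval v \<phi> = hat a"
    using tval_hat[of v \<phi>] assms by blast
  then show ?thesis
    by simp
qed

text \<open>This makes the values of \<open>TB \<phi>\<close> and \<open>TB (\<sim>\<phi>)\<close>
  usable as the value of a variable, which closure of \<open>tvalid\<close> under substitution
  requires.\<close>

lemma tval_twist:
  assumes "\<And>i. v i \<in> twist"
  shows "(tval v \<phi>, tval v (\<^bold>\<sim> \<phi>)) \<in> twist"
proof (induction \<phi>)
  case (Var i)
  then show ?case
    using assms[of i] cnf_box by (auto simp: twist_def)
next
  case Bot
  then show ?case using twist_bot by simp
next
  case (Con \<phi> \<psi>)
  then show ?case using twist_con by simp
next
  case (Dis \<phi> \<psi>)
  then show ?case
    using twist_swap[OF twist_con[OF twist_swap twist_swap]] by simp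
next
  case (Imp \<phi> \<psi>)
  \<comment> \<open>The translation puts a box on the first coordinate; since \<open>box\<close> is
    idempotent, the designation condition does not change.\<close>
  from twist_imp[OF this] show ?case
    using cnf_box by (simp add: twist_def)
next
  case (SNeg \<phi>)
  then show ?case using twist_swap by simp
qed

text \<open>On the right, variables acquire an additional box from the translation; it is absorbed
  because translated formulas take open values.\<close>

lemma tval_subst:
  assumes "\<And>i. v i \<in> twist"
  shows "tval v (subst \<sigma> \<phi>) = tval (\<lambda>i. (tval v (\<sigma> i), tval v (\<^bold>\<sim> (\<sigma> i)))) \<phi>"
  by (induction \<phi> rule: TB.induct) (simp_all add: box_tval[OF assms])

definition tvalid :: "fm set" where
  "tvalid = {\<phi>. TB \<phi> \<in> valid}"

lemma logic_tvalid: "logic tvalid"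
  unfolding logic_def
proof (intro conjI allI impI)
  fix \<sigma> \<phi> assume "\<phi> \<in> tvalid"
  then show "subst \<sigma> \<phi> \<in> tvalid"
    by (simp add: tvalid_def valid_def tval_subst tval_twist)
next
  fix \<phi> \<psi> assume asm: "\<phi> \<in> tvalid" "(\<phi> \<^bold>\<rightarrow> \<psi>) \<in> tvalid"
  have "tval v \<psi> = W" if "\<forall>i. v i \<in> twist" for v
  proof -
    have "tval v \<phi> = W" "box ((W - tval v \<phi>) \<union> tval v \<psi>) = W"
      using asm that by (simp_all add: tvalid_def valid_def)
    then show ?thesis
      using box_subset[of "tval v \<psi>"] mval_subset(1)[of v "TB \<psi>"] that by auto
  qed
  then show "\<psi> \<in> tvalid"
    by (simp add: tvalid_def valid_def)
qed

lemma box_imp_eq_W: "box ((W - x) \<union> y) = W \<longleftrightarrow> W \<inter> x \<subseteq> y"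
  using box_subset[of "(W - x) \<union> y"] box_subset_W by (auto simp: box_def)

text \<open>Residuation: on open sets, \<open>box ((W - y) \<union> z)\<close> is the Heyting
  implication.\<close>

lemma open_subset_box_imp:
  assumes "box u = u"
  shows "u \<subseteq> box ((W - y) \<union> z) \<longleftrightarrow> u \<inter> y \<subseteq> z"
proof
  show "u \<inter> y \<subseteq> z" if "u \<subseteq> box ((W - y) \<union> z)"
    using that box_subset by blast
  show "u \<subseteq> box ((W - y) \<union> z)" if "u \<inter> y \<subseteq> z"
  proof -
    have "u \<subseteq> (W - y) \<union> z"
      using that box_subset_W[of u] assms by auto
    from box_mono[OF this] show ?thesis
      by (simp add: assms)
  qed
qed

lemma box_mp: "w \<in> box ((W - y) \<union> z) \<Longrightarrow> w \<in> y \<Longrightarrow> w \<in> z"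
  using box_subset by blast

lemma N4_axioms_tvalid: "N4_axioms \<subseteq> tvalid"
proof -
  have I: "W \<inter> box x = box x" for x
    using box_subset_W by blast
  show ?thesis
    unfolding N4_axioms_def Let_def tvalid_def valid_def
    by (simp add: box_imp_eq_W I open_subset_box_imp box_Int box_W_Un)
      (auto dest!: box_mp)
qed

text \<open>Without strong negation in \<open>\<psi>\<close>, \<open>TB\<close> on
  \<open>\<psi>\<close> mirrors the clauses for \<open>hat\<close>. So it suffices to realise the
  values of \<open>q \<or> \<sim>q\<close> and of the remaining variables by formulas and to apply
  the resulting substitution to \<open>\<chi>\<close> within \<open>L\<close>.\<close>

lemma special_form_tvalid:
  assumes "\<chi> \<in> L" "special_form \<chi>"
  shows "\<chi> \<in> tvalid"
proof -
  obtain \<psi> Q where \<psi>: "sneg_free \<psi>"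
    and \<chi>: "\<chi> = subst (\<lambda>x. if x \<in> Q then Var x \<^bold>\<or> \<^bold>\<sim> (Var x) else Var x) \<psi>"
    using assms by (auto simp: special_form_def)
  have "tval v \<chi> = W" if "\<forall>i. v i \<in> twist" for v
  proof -
    have "\<exists>a. box (fst (v i)) = hat a" for i
      using that[rule_format, of i] by (simp add: twist_def case_prod_beta) (metis box_cnf)
    \<comment> \<open>A designated set is some \<open>hat c\<close> with
      \<open>hat (\<sim>c)\<close> empty, so adding the disjunct \<open>\<sim>c\<close> does not
      change it.\<close>
    moreover have "\<exists>c. box (fst (v i)) \<union> box (snd (v i)) = hat (c \<^bold>\<or> \<^bold>\<sim> c)" for i
      using that[rule_format, of i] by (simp add: twist_def case_prod_beta designated_def)
        (metis sup_bot_right)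
    ultimately obtain a c where ac: "\<And>i. box (fst (v i)) = hat (a i)"
      "\<And>i. box (fst (v i)) \<union> box (snd (v i)) = hat (c i \<^bold>\<or> \<^bold>\<sim> (c i))"
      by metis
    \<comment> \<open>In \<open>\<chi>\<close> a variable in \<open>Q\<close> occurs only within
      \<open>q \<or> \<sim>q\<close> and any other variable only bare, so one substitution can use
      \<open>c\<close> for the former and \<open>a\<close> for the latter.\<close>
    define \<rho> where "\<rho> i = (if i \<in> Q then c i else a i)" for i
    have "tval v (subst (\<lambda>x. if x \<in> Q then Var x \<^bold>\<or> \<^bold>\<sim> (Var x) else Var x) \<psi>) =
        hat (subst \<rho> (subst (\<lambda>x. if x \<in> Q then Var x \<^bold>\<or> \<^bold>\<sim> (Var x) else Var x) \<psi>))"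
      using \<psi> by (induction \<psi>) (use ac in \<open>simp_all add: \<rho>_def\<close>)
    then show ?thesis
      using assms(1) hat_L L_subst by (simp add: \<chi>)
  qed
  then show ?thesis
    by (simp add: tvalid_def valid_def)
qed

lemma tval_canonical: "tval (\<lambda>i. (hat (Var i), hat (\<^bold>\<sim> (Var i)))) \<phi> = hat \<phi>"
  by (induction \<phi> rule: TB.induct) simp_all

text \<open>The canonical valuation is admissible by \<open>designated_hat_sneg\<close>, and a
  formula whose value is all of \<open>W\<close> belongs to \<open>L\<close>.\<close>

lemma tvalid_subset_L: "tvalid \<subseteq> L"
proof
  fix \<phi> assume "\<phi> \<in> tvalid"
  moreover have "(hat (Var i), hat (\<^bold>\<sim> (Var i))) \<in> twist" for i
    by (simp add: twist_def cnf_hat designated_hat_sneg)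
  ultimately have "tval (\<lambda>i. (hat (Var i), hat (\<^bold>\<sim> (Var i)))) \<phi> = W"
    by (simp add: tvalid_def valid_def del: split_paired_All)
  then show "\<phi> \<in> L"
    by (intro L_if_hat) (simp add: tval_canonical)
qed

end

section \<open>Least logics and the modal companion\<close>

lemma least_logic_least: "logic K \<Longrightarrow> X \<subseteq> K \<Longrightarrow> least_logic X \<subseteq> K"
  by (auto simp: least_logic_def)

lemma subset_least_logic: "X \<subseteq> least_logic X"
  by (auto simp: least_logic_def)

lemma least_mlogic_least: "mlogic M \<Longrightarrow> X \<subseteq> M \<Longrightarrow> least_mlogic X \<subseteq> M"
  by (auto simp: least_mlogic_def)

lemma subset_least_mlogic: "X \<subseteq> least_mlogic X"
  by (auto simp: least_mlogic_def)

lemma mlogic_Inter: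
  assumes "\<And>M. M \<in> S \<Longrightarrow> mlogic M"
  shows "mlogic (\<Inter>S)"
  unfolding mlogic_def
proof (intro conjI allI impI InterI)
  fix \<sigma> \<phi> M assume "\<phi> \<in> \<Inter>S" "M \<in> S"
  then show "msubst \<sigma> \<phi> \<in> M"
    using assms[of M] by (simp add: mlogic_def)
next
  fix \<phi> \<psi> M assume "\<phi> \<in> \<Inter>S" "(\<phi> \<^bold>\<rightarrow>\<^sub>m \<psi>) \<in> \<Inter>S" "M \<in> S"
  then have "\<phi> \<in> M" "(\<phi> \<^bold>\<rightarrow>\<^sub>m \<psi>) \<in> M" "mlogic M"
    using assms by simp_all
  then show "\<psi> \<in> M"
    unfolding mlogic_def by metis
next
  fix \<phi> \<psi> M assume "(\<phi> \<^bold>\<rightarrow>\<^sub>m \<psi>) \<in> \<Inter>S" "M \<in> S"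
  then show "(\<^bold>\<box> \<phi> \<^bold>\<rightarrow>\<^sub>m \<^bold>\<box> \<psi>) \<in> M" "(\<^bold>\<diamond> \<phi> \<^bold>\<rightarrow>\<^sub>m \<^bold>\<diamond> \<psi>) \<in> M"
    using assms[of M] by (simp_all add: mlogic_def)
qed

lemma mlogic_least_mlogic: "mlogic (least_mlogic X)"
  unfolding least_mlogic_def by (rule mlogic_Inter) simp

theorem theorem4p1p5:
  fixes L X :: "fm set"
  assumes "N4bot_extension L"
    and "L = N4bot \<oplus> X"
    and "\<forall>\<chi>\<in>X. special_form \<chi>"
  shows "modal_companion (tau_B L) L"
proof -
  interpret n4_logic L
    using assms(1) subset_least_logic by unfold_locales (auto simp: N4bot_extension_def N4bot_def)
  have "X \<subseteq> L"
    using assms(2) subset_least_logic[of "N4bot \<union> X"] by (simp add: logic_plus_def)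
  \<comment> \<open>As \<open>tvalid\<close> is a logic, only the generators of \<open>L\<close>
    have to be checked; likewise for \<open>tau_B L\<close> and \<open>valid\<close> below.\<close>
  then have "N4bot \<union> X \<subseteq> tvalid"
    using least_logic_least[OF logic_tvalid N4_axioms_tvalid] special_form_tvalid assms(3)
    by (auto simp: N4bot_def)
  then have "L \<subseteq> tvalid"
    using assms(2) least_logic_least[OF logic_tvalid] by (simp add: logic_plus_def)
  then have "BS4 \<union> TB ` L \<subseteq> valid"
    using least_mlogic_least[OF mlogic_valid BS4_axioms_valid] by (auto simp: BS4_def tvalid_def)
  then have "tau_B L \<subseteq> valid"
    using least_mlogic_least[OF mlogic_valid] by (simp add: tau_B_def mlogic_plus_def)
  then have "\<phi> \<in> L" if "TB \<phi> \<in> tau_B L" for \<phi>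
    using that tvalid_subset_L by (auto simp: tvalid_def)
  moreover have "BS4 \<union> TB ` L \<subseteq> tau_B L"
    unfolding tau_B_def mlogic_plus_def by (rule subset_least_mlogic)
  moreover have "mlogic (tau_B L)"
    unfolding tau_B_def mlogic_plus_def by (rule mlogic_least_mlogic)
  ultimately show ?thesis
    by (auto simp: modal_companion_def BS4_extension_def)
qed

end
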